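(* Let $\kappa>0$ and let $$R_{0,1}(r)=c\,J_0(\alpha_{0,1}\,r)+d\,I_0\Bigl(\frac{\kappa}{\alpha_{0,1}}\,r\Bigr),$$ where $(c,d)\in\mathbb{R}^2$ is a nontrivial solution to $$\begin{cases} c\,J_0(\alpha)+d\,I_0(\kappa/\alpha)=0,\\ c\,\alpha J_0'(\alpha)+d\,\frac{\kappa}{\alpha}I_0'(\kappa/\alpha)=0,\end{cases}\qquad\text{with }\alpha=\alpha_{0,1}.$$ Then $r\mapsto|R_{0,1}(r)|$ is positive in $[0,1[$ and decreasing.
   Context: $J_0$ (resp. $I_0$) is the Bessel function (resp. modified Bessel function) of the first kind of order $0$. For $\kappa>0$, $\alpha_{0,1}=\alpha_{0,1}(\kappa)$ denotes the smallest positive root of $$F_0(\alpha)=\frac{\kappa}{\alpha}J_0(\alpha)I_0'\Bigl(\frac{\kappa}{\alpha}\Bigr)-\alpha I_0\Bigl(\frac{\kappa}{\alpha}\Bigr)J_0'(\alpha),\qquad\alpha>0$$ (at such a root the linear system has nontrivial solutions). The function $R_{0,1}$ is considered on $[0,1]$; it is the radial eigenfunction for the first eigenvalue of $\Delta^2u-\kappa^2u=-\lambda\Delta u$ in the unit disk with $u=\partial_ru=0$ on the boundary. *)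

theory Defs
  imports "HOL-Analysis.Analysis"
begin

definition bessel_J :: "nat \<Rightarrow> real \<Rightarrow> real" where
  "bessel_J n x = (\<Sum>k. (-1) ^ k / (fact k * fact (n + k)) * (x / 2) ^ (n + 2 * k))"

definition bessel_I :: "nat \<Rightarrow> real \<Rightarrow> real" where
  "bessel_I n x = (\<Sum>k. 1 / (fact k * fact (n + k)) * (x / 2) ^ (n + 2 * k))"

definition F0 :: "real \<Rightarrow> real \<Rightarrow> real" where
  "F0 \<kappa> \<alpha> = \<kappa> / \<alpha> * bessel_J 0 \<alpha> * deriv (bessel_I 0) (\<kappa> / \<alpha>)
            - \<alpha> * bessel_I 0 (\<kappa> / \<alpha>) * deriv (bessel_J 0) \<alpha>"

text \<open>\<open>LEAST\<close> on the reals is unspecified when no least element exists, so any use of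
  \<open>alpha01\<close> requires that, for \<open>\<kappa> > 0\<close>, the positive roots of \<open>F0 \<kappa>\<close> have a minimum.\<close>

definition alpha01 :: "real \<Rightarrow> real" where
  "alpha01 \<kappa> = (LEAST \<alpha>. 0 < \<alpha> \<and> F0 \<kappa> \<alpha> = 0)"

definition R01 :: "real \<Rightarrow> real \<Rightarrow> real \<Rightarrow> real \<Rightarrow> real" where
  "R01 \<kappa> c d r = c * bessel_J 0 (alpha01 \<kappa> * r) + d * bessel_I 0 (\<kappa> / alpha01 \<kappa> * r)"

end

theory Submission
  imports Defs
begin

text \<open>With \<open>B\<^sub>n(t) = \<Sum>\<^sub>k t\<^sup>k / (k! (n+k)!)\<close> one has \<open>J\<^sub>0(x) = B\<^sub>0(-x\<^sup>2/4)\<close>,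
  \<open>I\<^sub>0(x) = B\<^sub>0(x\<^sup>2/4)\<close> and \<open>B\<^sub>n' = B\<^sub>n\<^sub>+\<^sub>1\<close>. Let \<open>-s\<^sub>1\<close> be the first negative zero of \<open>B\<^sub>1\<close>.
  Since \<open>(t\<^sup>2 B\<^sub>2)' = t B\<^sub>1\<close>, \<open>B\<^sub>2 > 0\<close> on \<open>[-s\<^sub>1, 0]\<close>, and
  \<open>B\<^sub>0(-s\<^sub>1) = -s\<^sub>1 B\<^sub>2(-s\<^sub>1) < 0\<close>. Hence \<open>F0\<close> is positive up to the first zero of \<open>J\<^sub>0\<close> and negative at
  the first zero of \<open>J\<^sub>1\<close>, so its first root \<open>\<alpha>\<close> lies strictly between these, and
  \<open>J\<^sub>0(\<alpha>) < 0\<close> forces \<open>d / c > 0\<close>. In the variable \<open>\<rho> = r\<^sup>2\<close> the profile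
  \<open>V(\<rho>) = B\<^sub>0(-a\<rho>) + (d/c) B\<^sub>0(b\<rho>)\<close> is then strictly convex on \<open>[0,1]\<close> with
  \<open>V(1) = V'(1) = 0\<close>, hence strictly decreasing and positive on \<open>[0,1)\<close>.\<close>

section \<open>Bessel-Clifford functions: series, derivative and recurrence\<close>

definition bessel_B :: "nat \<Rightarrow> real \<Rightarrow> real" where
  "bessel_B n t = (\<Sum>k. inverse (fact k * fact (n + k)) * t ^ k)"

lemma bessel_B_summable: "summable (\<lambda>k. inverse (fact k * fact (n + k)) * (t::real) ^ k)"
proof (rule summable_comparison_test')
  show "summable (\<lambda>k. inverse (fact k) * \<bar>t\<bar> ^ k)"
    by (rule summable_exp)
next
  fix k :: nat
  have "inverse (fact k * fact (n + k)) \<le> (inverse (fact k) :: real)"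
    by (simp add: divide_simps)
  then show "norm (inverse (fact k * fact (n + k)) * t ^ k) \<le> inverse (fact k) * \<bar>t\<bar> ^ k"
    by (simp add: abs_mult power_abs mult_right_mono)
qed

lemma bessel_B_has_derivative:
  "(bessel_B n has_field_derivative bessel_B (Suc n) t) (at t)"
proof -
  let ?c = "\<lambda>k. inverse (fact k * fact (n + k)) :: real"
  have "diffs ?c = (\<lambda>k. inverse (fact k * fact (Suc n + k)))"
    by (auto simp: diffs_def fun_eq_iff divide_simps simp del: fact_Suc) simp
  then show ?thesis
    using termdiffs_strong_converges_everywhere[of ?c t, OF bessel_B_summable]
    by (simp add: bessel_B_def[abs_def])
qed

lemmas bessel_B_derivative_intros [derivative_intros] =
  bessel_B_has_derivative[THEN DERIV_chain2]

lemma continuous_on_bessel_B [continuous_intros]: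
  "continuous_on S f \<Longrightarrow> continuous_on S (\<lambda>x. bessel_B n (f x))"
  by (rule continuous_on_compose2[of UNIV "bessel_B n"])
    (auto intro!: DERIV_continuous_on bessel_B_has_derivative)

lemma bessel_B_0: "bessel_B n 0 = inverse (fact n)"
  using powser_zero[of "\<lambda>k. inverse (fact k * fact (n + k)) :: real"]
  by (simp add: bessel_B_def)

lemma bessel_B_pos:
  assumes "t \<ge> 0" shows "bessel_B n t > 0"
  unfolding bessel_B_def
  by (rule suminf_pos2[where i = 0]) (use assms bessel_B_summable in auto)

text \<open>Comparing coefficients of \<open>t^(k+1)\<close> over a common denominator leaves
  \<open>n + k + 2 = (n + 1) + (k + 1)\<close>. Combined with
  \<open>bessel_B_has_derivative\<close>, this is Bessel's equation
  \<open>t B_n'' + (n+1) B_n' = B_n\<close>.\<close>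

lemma bessel_B_recurrence:
  "bessel_B n t = t * bessel_B (n + 2) t + (real n + 1) * bessel_B (n + 1) t"
proof -
  let ?f = "\<lambda>m k. inverse (fact k * fact (m + k)) * t ^ k"
  have s: "?f m sums bessel_B m t" for m
    unfolding bessel_B_def by (rule summable_sums[OF bessel_B_summable])
  have tail: "(\<lambda>k. ?f m (Suc k)) sums (bessel_B m t - inverse (fact m))" for m
    using s[of m] by (subst sums_Suc_iff) simp
  have "(\<lambda>k. t * ?f (n + 2) k + (real n + 1) * ?f (n + 1) (Suc k)) sums
      (t * bessel_B (n + 2) t + (real n + 1) * (bessel_B (n + 1) t - inverse (fact (n + 1))))"
    by (intro sums_add sums_mult s tail)
  also have "(\<lambda>k. t * ?f (n + 2) k + (real n + 1) * ?f (n + 1) (Suc k)) = (\<lambda>k. ?f n (Suc k))"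
  proof
    fix k
    have "t * ?f (n + 2) k + (real n + 1) * ?f (n + 1) (Suc k) =
        t ^ Suc k * (inverse (fact k * ((real n + real k + 2) * fact (n + 1 + k)))
          + (real n + 1) * inverse ((real k + 1) * fact k * ((real n + real k + 2) * fact (n + 1 + k))))"
      by (simp add: algebra_simps)
    also have "inverse (fact k * ((real n + real k + 2) * fact (n + 1 + k)))
          + (real n + 1) * inverse ((real k + 1) * fact k * ((real n + real k + 2) * fact (n + 1 + k)))
        = inverse ((real k + 1) * fact k * fact (n + 1 + k))"
    proof -
      \<comment> \<open>Used with \<open>q = n + k + 2\<close>, \<open>m = n + 1\<close> and
        \<open>l = k + 1\<close>.\<close>
      have *: "inverse (p * (q * r)) + m * inverse (l * p * (q * r)) = inverse (l * p * r)"
        if "p > 0" "q > 0" "r > 0" "l > 0" "q = m + l" for p q r l m :: real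
      proof -
        have "inverse (p * (q * r)) = l * inverse (l * p * (q * r))"
          "inverse (l * p * r) = q * inverse (l * p * (q * r))"
          using that(1-4) by (simp_all add: divide_simps)
        then show ?thesis
          using that(5) by (simp add: distrib_right)
      qed
      show ?thesis by (rule *) auto
    qed
    finally show "t * ?f (n + 2) k + (real n + 1) * ?f (n + 1) (Suc k) = ?f n (Suc k)"
      by (simp add: algebra_simps)
  qed
  finally have "t * bessel_B (n + 2) t + (real n + 1) * (bessel_B (n + 1) t - inverse (fact (n + 1)))
      = bessel_B n t - inverse (fact n)"
    using tail[of n] sums_unique2 by blast
  moreover have "(real n + 1) * inverse (fact (n + 1)) = (inverse (fact n) :: real)"
  proof -
    have "real n + 1 \<noteq> 0" by linarith
    moreover have "fact (n + 1) = (real n + 1) * fact n" by (simp add: algebra_simps)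
    ultimately show ?thesis by (simp only: inverse_mult_distrib) simp
  qed
  ultimately show ?thesis
    unfolding right_diff_distrib by linarith
qed

section \<open>The order-zero Bessel functions and their derivatives through
  \<open>bessel_B\<close>\<close>

lemma bessel_J_0_eq: "bessel_J 0 x = bessel_B 0 (- (x\<^sup>2 / 4))"
proof -
  have "(-1) ^ k / (fact k * fact k) * (x / 2) ^ (2 * k)
      = inverse (fact k * fact k) * (- (x\<^sup>2 / 4)) ^ k" for k
  proof -
    have "(- (x\<^sup>2 / 4)) ^ k = (-1) ^ k * (x / 2) ^ (2 * k)"
      unfolding power_mult by (subst power_mult_distrib[symmetric]) (simp add: power_divide)
    then show ?thesis by (simp add: inverse_eq_divide)
  qed
  then show ?thesis by (simp add: bessel_J_def bessel_B_def)
qed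

lemma bessel_I_0_eq: "bessel_I 0 x = bessel_B 0 (x\<^sup>2 / 4)"
proof -
  have "(x / 2) ^ (2 * k) = (x\<^sup>2 / 4) ^ k" for k
    unfolding power_mult by (simp add: power_divide)
  then show ?thesis by (simp add: bessel_I_def bessel_B_def inverse_eq_divide)
qed

lemma deriv_bessel_J_0: "deriv (bessel_J 0) x = - (x / 2) * bessel_B 1 (- (x\<^sup>2 / 4))"
  unfolding bessel_J_0_eq[abs_def]
  by (rule DERIV_imp_deriv) (auto intro!: derivative_eq_intros)

lemma deriv_bessel_I_0: "deriv (bessel_I 0) x = x / 2 * bessel_B 1 (x\<^sup>2 / 4)"
  unfolding bessel_I_0_eq[abs_def]
  by (rule DERIV_imp_deriv) (auto intro!: derivative_eq_intros)

section \<open>First zeros and signs of \<open>B_1\<close> and \<open>B_2\<close>\<close>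

lemma first_zero:
  fixes f :: "real \<Rightarrow> real"
  assumes "continuous_on {a..b} f" "a \<le> b" "f a > 0" "f b \<le> 0"
  obtains z where "a < z" "z \<le> b" "f z = 0" "\<And>x. a \<le> x \<Longrightarrow> x < z \<Longrightarrow> f x > 0"
proof -
  \<comment> \<open>The zero set is compact and nonempty, so it has a least element; a nonpositive
    value before it would produce an earlier zero by the intermediate value theorem.\<close>
  let ?Z = "{x \<in> {a..b}. f x = 0}"
  have "closed ?Z"
    using continuous_closed_preimage_constant[OF assms(1)] by simp
  then have "compact ?Z"
    using bounded_subset[OF bounded_closed_interval, of ?Z a b] compact_eq_bounded_closed by blast
  moreover have "?Z \<noteq> {}"
    using IVT2'[of f b 0 a] assms by auto
  ultimately obtain z where z: "z \<in> ?Z" "\<And>y. y \<in> ?Z \<Longrightarrow> z \<le> y"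
    using compact_attains_inf[of ?Z] by blast
  have "f x > 0" if x: "a \<le> x" "x < z" for x
  proof (rule ccontr)
    assume "\<not> f x > 0"
    moreover have "continuous_on {a..x} f"
      using assms(1) by (rule continuous_on_subset) (use that z in auto)
    ultimately obtain y where "a \<le> y" "y \<le> x" "f y = 0"
      using IVT2'[of f x 0 a] assms(3) x by auto
    with z(2)[of y] z(1) x show False by auto
  qed
  moreover have "a < z" using z(1) assms(3) by (cases "a = z") auto
  ultimately show ?thesis using that[of z] z(1) by simp
qed

text \<open>Since \<open>J_1(x) = (x/2) B_1(-x^2/4)\<close>, this says \<open>J_1(4) < 0\<close>;
  the first positive zero of \<open>J_1\<close> is about 3.83. It bounds the search for
  \<open>s1\<close> by 4.\<close>

lemma bessel_B_1_neg: "bessel_B 1 (-4) < 0"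
proof -
  \<comment> \<open>The terms of the series have absolute values 1, 2, 4/3, ...; they decrease only
    from index 1 on, so the constant term is split off before applying the Leibniz
    criterion.\<close>
  define a :: "nat \<Rightarrow> real" where "a k = inverse (fact (Suc k) * fact (1 + Suc k)) * 4 ^ Suc k" for k
  have term_eq: "inverse (fact (Suc k) * fact (1 + Suc k)) * (-4) ^ Suc k = - ((-1) ^ k * a k)" for k
    using power_mult_distrib[of "-1::real" 4 "Suc k"] by (simp add: a_def)
  have "bessel_B 1 (-4) = 1 - (\<Sum>k. (-1) ^ k * a k)"
  proof -
    have "summable (\<lambda>k. - ((-1) ^ k * a k))"
      using bessel_B_summable[of 1 "-4"] unfolding term_eq[symmetric] by (subst summable_Suc_iff)
    then have "summable (\<lambda>k. (-1) ^ k * a k)" by (simp add: summable_minus_iff)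
    then show ?thesis
      unfolding bessel_B_def suminf_split_head[OF bessel_B_summable, of 1 "-4", symmetric]
      using suminf_split_head[OF bessel_B_summable, of 1 "-4"]
      unfolding term_eq by (simp add: suminf_minus)
  qed
  \<comment> \<open>Even partial sums bound the alternating sum from below; four terms suffice,
    giving 46/45 > 1.\<close>
  moreover have "(\<Sum>k<2 * 2. (-1) ^ k * a k) \<le> (\<Sum>k. (-1) ^ k * a k)"
  proof (rule summable_Leibniz'(2))
    show "a \<longlonglongrightarrow> 0"
      unfolding a_def
      using summable_LIMSEQ_zero[OF bessel_B_summable[of 1 4]]
      by (rule LIMSEQ_Suc)
    show "0 \<le> a n" for n by (simp add: a_def)
    show "a (Suc n) \<le> a n" for n
    proof -
      have "a (Suc n) = a n * (4 / ((real n + 2) * (real n + 3)))"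
        by (simp add: a_def divide_simps) (simp add: algebra_simps)
      also have "\<dots> \<le> a n * 1"
      proof (rule mult_left_mono)
        have "4 \<le> (real n + 2) * (real n + 3)"
          by (simp add: algebra_simps)
        then show "4 / ((real n + 2) * (real n + 3)) \<le> 1" by simp
      qed (simp add: a_def)
      finally show ?thesis by simp
    qed
  qed
  moreover have "(\<Sum>k<2 * 2. (-1) ^ k * a k) = 46 / 45"
    by (simp add: a_def eval_nat_numeral lessThan_Suc fact_numeral)
  ultimately show ?thesis by simp
qed

text \<open>By the recurrence with \<open>n = 1\<close>, \<open>x^2 B_2(-x)\<close> has derivative
  \<open>x B_1(-x)\<close>, so it increases from 0. Positivity of the derivative inside the interval
  is enough, which lets \<open>x = s\<close> be included, where \<open>B_1\<close> may
  vanish.\<close>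

lemma bessel_B_2_pos:
  assumes pos: "\<And>x. 0 \<le> x \<Longrightarrow> x < s \<Longrightarrow> bessel_B 1 (- x) > 0" and "0 \<le> x" "x \<le> s"
  shows "bessel_B 2 (- x) > 0"
proof (cases "x = 0")
  case False
  let ?g = "\<lambda>x. x\<^sup>2 * bessel_B 2 (- x)"
  have "?g 0 < ?g x"
  proof (rule DERIV_pos_imp_increasing_open[where f = ?g])
    fix y assume y: "0 < y" "y < x"
    have "(?g has_real_derivative y * bessel_B 1 (- y)) (at y)"
    proof -
      have "y * bessel_B 1 (- y) = 2 * y * bessel_B 2 (- y) - y\<^sup>2 * bessel_B 3 (- y)"
        unfolding bessel_B_recurrence[of 1 "- y"]
        by (simp add: algebra_simps numeral_2_eq_2 numeral_3_eq_3)
      then show ?thesis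
        by (auto intro!: derivative_eq_intros simp: numeral_2_eq_2 numeral_3_eq_3)
    qed
    then show "\<exists>z. (?g has_real_derivative z) (at y) \<and> 0 < z"
      using pos[of y] y assms(3) by auto
  qed (use False assms(2) in \<open>auto intro!: continuous_intros\<close>)
  then show ?thesis by (simp add: zero_less_mult_iff)
qed (simp add: bessel_B_0)

section \<open>Location of the first root of \<open>F0\<close>\<close>

lemma F0_eq:
  "F0 \<kappa> x = (\<kappa> / x)\<^sup>2 / 2 * bessel_B 0 (- (x\<^sup>2 / 4)) * bessel_B 1 ((\<kappa> / x)\<^sup>2 / 4)
     + x\<^sup>2 / 2 * bessel_B 0 ((\<kappa> / x)\<^sup>2 / 4) * bessel_B 1 (- (x\<^sup>2 / 4))"
  unfolding F0_def bessel_J_0_eq bessel_I_0_eq deriv_bessel_J_0 deriv_bessel_I_0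
  by (simp add: power2_eq_square mult_ac)

text \<open>Shows that the \<open>LEAST\<close> is attained and supplies the two signs used later:
  \<open>B_0(-a) < 0\<close> makes \<open>d / c\<close> positive, and \<open>B_2 > 0\<close> on
  \<open>[-a, 0]\<close> gives convexity of the profile.\<close>

lemma alpha01_properties:
  assumes "\<kappa> > 0"
  defines "a \<equiv> (alpha01 \<kappa>)\<^sup>2 / 4"
  shows "alpha01 \<kappa> > 0" "bessel_B 0 (- a) < 0"
    and "\<And>x. 0 \<le> x \<Longrightarrow> x \<le> a \<Longrightarrow> bessel_B 2 (- x) > 0"
proof -
  have "continuous_on {0..4} (\<lambda>x. bessel_B 1 (- x))" by (intro continuous_intros)
  moreover have "(0::real) \<le> 4" "0 < bessel_B 1 (- 0)" "bessel_B 1 (- 4) \<le> 0"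
    using bessel_B_1_neg by (auto simp: bessel_B_0)
  ultimately obtain s1 where s1: "0 < s1" "s1 \<le> 4" "bessel_B 1 (- s1) = 0"
    and B1: "\<And>x. 0 \<le> x \<Longrightarrow> x < s1 \<Longrightarrow> bessel_B 1 (- x) > 0"
    by (rule first_zero) blast
  have B2: "bessel_B 2 (- x) > 0" if "0 \<le> x" "x \<le> s1" for x
    using bessel_B_2_pos[OF B1] that by blast
  have B0_s1: "bessel_B 0 (- s1) < 0"
    using bessel_B_recurrence[of 0 "- s1"] s1 B2[of s1] by (simp add: numeral_eq_Suc)
  have "continuous_on {0..s1} (\<lambda>x. bessel_B 0 (- x))" by (intro continuous_intros)
  moreover have "0 \<le> s1" "0 < bessel_B 0 (- 0)" "bessel_B 0 (- s1) \<le> 0"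
    using B0_s1 s1 by (auto simp: bessel_B_0)
  ultimately obtain s0 where s0: "0 < s0" "s0 \<le> s1" "bessel_B 0 (- s0) = 0"
    and B0: "\<And>x. 0 \<le> x \<Longrightarrow> x < s0 \<Longrightarrow> bessel_B 0 (- x) > 0"
    by (rule first_zero) blast
  have "s0 < s1" using s0 B0_s1 by (cases "s0 = s1") auto
  \<comment> \<open>The first positive zeros of \<open>J_0\<close> and \<open>J_1\<close>, recovered
    from \<open>s = x^2/4\<close>.\<close>
  define x0 x1 where "x0 = 2 * sqrt s0" and "x1 = 2 * sqrt s1"
  have x: "0 < x0" "x0 < x1" "x0\<^sup>2 / 4 = s0" "x1\<^sup>2 / 4 = s1"
    using s0 s1 \<open>s0 < s1\<close> by (auto simp: x0_def x1_def power_mult_distrib)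
  have F0_pos: "F0 \<kappa> y > 0" if "0 < y" "y \<le> x0" for y
  proof -
    have "y\<^sup>2 \<le> x0\<^sup>2" using that by (intro power_mono) auto
    then have y: "y\<^sup>2 / 4 \<le> s0" using x by simp
    then have "bessel_B 0 (- (y\<^sup>2 / 4)) \<ge> 0"
      using B0[of "y\<^sup>2 / 4"] s0 by (cases "y\<^sup>2 / 4 = s0") (auto simp: less_imp_le)
    moreover have "bessel_B 1 (- (y\<^sup>2 / 4)) > 0"
      using B1[of "y\<^sup>2 / 4"] y \<open>s0 < s1\<close> by simp
    ultimately show ?thesis
      unfolding F0_eq using that bessel_B_pos[of "(\<kappa> / y)\<^sup>2 / 4"]
      by (intro add_nonneg_pos mult_nonneg_nonneg mult_pos_pos) (auto simp: less_imp_le)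
  qed
  \<comment> \<open>The second summand of \<open>F0_eq\<close> vanishes because
    \<open>B_1(-s1) = 0\<close>; the first has the sign of \<open>B_0(-s1)\<close>.\<close>
  have F0_x1: "F0 \<kappa> x1 < 0"
    unfolding F0_eq x using assms(1) x s1 B0_s1 bessel_B_pos[of "(\<kappa> / x1)\<^sup>2 / 4" 1]
    by (auto simp: mult_less_0_iff zero_less_mult_iff)
  have "continuous_on {x0..x1} (F0 \<kappa>)"
    unfolding F0_eq[abs_def] using x by (auto intro!: continuous_intros)
  moreover have "x0 \<le> x1" "0 < F0 \<kappa> x0" "F0 \<kappa> x1 \<le> 0"
    using F0_pos[of x0] F0_x1 x by auto
  ultimately obtain z where z: "x0 < z" "z \<le> x1" "F0 \<kappa> z = 0"
    and F0_pos': "\<And>y. x0 \<le> y \<Longrightarrow> y < z \<Longrightarrow> F0 \<kappa> y > 0"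
    by (rule first_zero) blast
  have alpha: "alpha01 \<kappa> = z"
    unfolding alpha01_def
  proof (rule Least_equality)
    fix y assume y: "0 < y \<and> F0 \<kappa> y = 0"
    show "z \<le> y"
      \<comment> \<open>\<open>F0_pos\<close> excludes roots up to \<open>x0\<close>,
        \<open>F0_pos'\<close> those from \<open>x0\<close> to \<open>z\<close>.\<close>
      using F0_pos[of y] F0_pos'[of y] y by (cases "y \<le> x0") fastforce+
  qed (use z x in auto)
  show "alpha01 \<kappa> > 0" using alpha z x by simp
  have "z < x1" using z F0_x1 by (cases "z = x1") auto
  then have "z\<^sup>2 < x1\<^sup>2" using z x by (intro power_strict_mono) auto
  then have "a < s1" using x by (simp add: a_def alpha)
  have "a > 0" using z x by (simp add: a_def alpha)
  show "bessel_B 2 (- x) > 0" if "0 \<le> x" "x \<le> a" for x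
    using B2[of x] that \<open>a < s1\<close> by simp
  show "bessel_B 0 (- a) < 0"
  \<comment> \<open>Otherwise the first summand of \<open>F0_eq\<close> at \<open>z\<close> would be
    nonnegative and the second positive, although \<open>z\<close> is a root.\<close>
  proof (rule ccontr)
    assume "\<not> bessel_B 0 (- a) < 0"
    moreover have "bessel_B 1 (- a) > 0" using B1 \<open>0 < a\<close> \<open>a < s1\<close> by simp
    ultimately have "F0 \<kappa> z > 0"
      unfolding F0_eq using z x bessel_B_pos[of "(\<kappa> / z)\<^sup>2 / 4"]
      by (intro add_nonneg_pos mult_nonneg_nonneg mult_pos_pos)
        (auto simp: less_imp_le a_def alpha)
    with z show False by simp
  qed
qed

section \<open>Convexity and monotonicity of the radial profile\<close>

theorem theorem12:
  fixes \<kappa> \<alpha> c d :: real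
  assumes "\<kappa> > 0"
    and "\<alpha> = alpha01 \<kappa>"
    and "(c, d) \<noteq> (0, 0)"
    and "c * bessel_J 0 \<alpha> + d * bessel_I 0 (\<kappa> / \<alpha>) = 0"
    and "c * \<alpha> * deriv (bessel_J 0) \<alpha> + d * (\<kappa> / \<alpha>) * deriv (bessel_I 0) (\<kappa> / \<alpha>) = 0"
  shows "(\<forall>r \<in> {0..<1}. \<bar>R01 \<kappa> c d r\<bar> > 0) \<and>
         strict_antimono_on {0..1} (\<lambda>r. \<bar>R01 \<kappa> c d r\<bar>)"
proof -
  define a b where "a = \<alpha>\<^sup>2 / 4" and "b = (\<kappa> / \<alpha>)\<^sup>2 / 4"
  note \<alpha> = alpha01_properties[OF assms(1), folded assms(2), folded a_def]
  have ab: "a > 0" "b > 0" using \<alpha>(1) assms(1) by (auto simp: a_def b_def)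
  have bc0: "c * bessel_B 0 (- a) + d * bessel_B 0 b = 0"
    using assms(4) by (simp add: bessel_J_0_eq bessel_I_0_eq a_def b_def)
  have "c * (- (2 * a) * bessel_B 1 (- a)) + d * (2 * b * bessel_B 1 b) = 0"
    using assms(5) unfolding deriv_bessel_J_0 deriv_bessel_I_0 a_def b_def
    by (simp add: power2_eq_square algebra_simps)
  then have bc1: "d * b * bessel_B 1 b = c * a * bessel_B 1 (- a)"
    by (simp add: algebra_simps)
  have B0b: "bessel_B 0 b > 0" using bessel_B_pos ab by simp
  have c: "c \<noteq> 0" using bc0 B0b assms(3) by auto
  define e where "e = d / c"
  have d: "d = c * e" using c by (simp add: e_def)
  \<comment> \<open>After division by \<open>c\<close>, the two boundary conditions become
    \<open>V 1 = 0\<close> (\<open>e0\<close>) and \<open>V' 1 = 0\<close>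
    (\<open>e1\<close>).\<close>
  have e0: "bessel_B 0 (- a) + e * bessel_B 0 b = 0"
    using bc0 c unfolding d by (simp add: mult.assoc flip: distrib_left)
  have e1: "e * b * bessel_B 1 b = a * bessel_B 1 (- a)"
    using bc1 c unfolding d by (simp add: mult.assoc)
  have "e * bessel_B 0 b > 0" using e0 \<alpha>(2) by linarith
  then have e: "e > 0" using B0b by (simp add: zero_less_mult_iff)
  define V where "V \<rho> = bessel_B 0 (- (a * \<rho>)) + e * bessel_B 0 (b * \<rho>)" for \<rho>
  define V' where "V' \<rho> = - a * bessel_B 1 (- (a * \<rho>)) + e * b * bessel_B 1 (b * \<rho>)" for \<rho>
  define V'' where "V'' \<rho> = a\<^sup>2 * bessel_B 2 (- (a * \<rho>)) + e * b\<^sup>2 * bessel_B 2 (b * \<rho>)" for \<rho>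
  have dV: "(V has_real_derivative V' \<rho>) (at \<rho>)" for \<rho>
    unfolding V_def[abs_def] V'_def by (auto intro!: derivative_eq_intros)
  have dV': "(V' has_real_derivative V'' \<rho>) (at \<rho>)" for \<rho>
    unfolding V'_def[abs_def] V''_def
    by (auto intro!: derivative_eq_intros simp: power2_eq_square numeral_eq_Suc)
  have V''_pos: "V'' \<rho> > 0" if "0 \<le> \<rho>" "\<rho> \<le> 1" for \<rho>
    unfolding V''_def using that ab e \<alpha>(3)[of "a * \<rho>"] bessel_B_pos[of "b * \<rho>" 2]
    by (intro add_pos_pos mult_pos_pos) (auto simp: mult_left_le)
  have V'_neg: "V' \<rho> < 0" if "0 \<le> \<rho>" "\<rho> < 1" for \<rho>
  proof -
    have "V' \<rho> < V' 1"
      by (rule DERIV_pos_imp_increasing[OF that(2)]) (use that dV' V''_pos in \<open>meson order_trans\<close>)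
    then show ?thesis using e1 by (simp add: V'_def)
  qed
  have V_decreasing: "V y < V x" if "0 \<le> x" "x < y" "y \<le> 1" for x y
  \<comment> \<open>The open-interval criterion is used because \<open>y = 1\<close> is allowed and
    \<open>V' 1 = 0\<close>.\<close>
  proof (rule DERIV_neg_imp_decreasing_open[OF that(2)])
    show "continuous_on {x..y} V"
      using dV by (auto intro!: DERIV_continuous_on intro: DERIV_subset)
  qed (use that dV V'_neg in \<open>meson order.strict_trans1 order.strict_trans2 less_imp_le\<close>)
  have V1: "V 1 = 0" using e0 by (simp add: V_def)
  have R: "\<bar>R01 \<kappa> c d r\<bar> = \<bar>c\<bar> * \<bar>V (r\<^sup>2)\<bar>" for r
    unfolding abs_mult[symmetric] R01_def V_def d bessel_J_0_eq bessel_I_0_eq a_def b_def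
      assms(2)[symmetric]
    by (simp add: algebra_simps power_divide power_mult_distrib)
  have V_pos: "V \<rho> > 0" if "0 \<le> \<rho>" "\<rho> < 1" for \<rho>
    using V_decreasing[of \<rho> 1] that V1 by simp
  have "\<bar>R01 \<kappa> c d y\<bar> < \<bar>R01 \<kappa> c d x\<bar>" if "0 \<le> x" "x < y" "y \<le> 1" for x y
  proof -
    \<comment> \<open>Squaring is strictly increasing on \<open>[0,1]\<close> and maps it to itself,
      so monotonicity of \<open>V\<close> transfers to \<open>r\<close>; \<open>V \<ge> 0\<close>
      there removes the absolute value.\<close>
    have *: "x\<^sup>2 < y\<^sup>2" "y\<^sup>2 \<le> 1"
      using that by (auto intro!: power_strict_mono power_le_one)
    then have "V (y\<^sup>2) \<ge> 0"
      using V_pos[of "y\<^sup>2"] V1 by (cases "y\<^sup>2 = 1") (auto simp: less_imp_le)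
    then show ?thesis
      unfolding R using V_decreasing[of "x\<^sup>2" "y\<^sup>2"] * c by simp
  qed
  moreover have "\<bar>R01 \<kappa> c d r\<bar> > 0" if "0 \<le> r" "r < 1" for r
    unfolding R using that c V_pos[of "r\<^sup>2"] by (simp add: power_less_one_iff)
  ultimately show ?thesis
    by (auto simp: monotone_on_def)
qed

end
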